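(* For $|q|<1$, $$\sum_{h=0}^\infty\sum_{i=0}^\infty\sum_{k=0}^\infty\frac{q^{k+i+2i(h+i+k)+(h+k)^2}}{(q^2;q^2)_h(q^2;q^2)_i(q^2;q^2)_k}=\prod_{j=1}^\infty(1+q^j)$$ and $$\prod_{j=1}^\infty(1+q^{2j-1})\sum_{j=0}^\infty\frac{q^{j(j+1)}}{(q^2;q^2)_j}=\prod_{j=1}^\infty(1+q^j).$$
   Context: $(a;p)_n=\prod_{i=0}^{n-1}(1-ap^i)$. *)

theory Defs
  imports "HOL-Analysis.Analysis"
begin

definition qpoch :: "'a::comm_ring_1 \<Rightarrow> 'a \<Rightarrow> nat \<Rightarrow> 'a" where
  "qpoch a p n = (\<Prod>i<n. 1 - a * p ^ i)"

end

theory Submission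
  imports Defs
begin

text \<open>
  Write \<open>p = q\<^sup>2\<close> and \<open>(a)\<^sub>n\<close> for \<open>qpoch a p n\<close>. Everything comes from two classical expansions:
  Euler's series \<open>\<Sum>n. p ^ (n choose 2) * z ^ n / (p)\<^sub>n = (\<Prod>j. 1 + z * p ^ j)\<close> (\<open>euler_sums\<close>) and its
  finite form, the q-binomial theorem (\<open>qbinomial_theorem\<close>).

  For \<open>z = p\<close> the terms of Euler's series are \<open>q ^ (n * (n + 1)) / (p)\<^sub>n\<close>, so the single sum is the product
  of the \<open>1 + q ^ j\<close> over the even \<open>j > 0\<close>. Multiplying by the factors with odd \<open>j\<close> gives the second
  identity.

  The triple sum is reduced to the left-hand side of the second identity by eliminating two of
  the three indices. Its exponent is
  \<open>2 * (h choose 2) + (1 + 2 * (i + k)) * h + (i + k) * (i + k + 1) + i\<^sup>2\<close>, so that for fixed \<open>i\<close> and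
  \<open>k\<close> the sum over \<open>h\<close> is Euler's series at \<open>z = q * p ^ (i + k)\<close>. Its value is a tail of
  \<open>\<Prod>j. 1 + q * p ^ j\<close>, that is, the whole product divided by \<open>(- q)\<^sub>i\<^sub>+\<^sub>k\<close>. On the diagonal
  \<open>i + k = n\<close> there remains the sum of \<open>q ^ i\<^sup>2 / ((p)\<^sub>i * (p)\<^sub>n\<^sub>-\<^sub>i)\<close>, which the q-binomial theorem
  at \<open>z = q\<close> evaluates to \<open>(- q)\<^sub>n / (p)\<^sub>n\<close>. The factors \<open>(- q)\<^sub>n\<close> cancel. The rearrangement is
  legitimate because the triple series converges absolutely (\<open>triple_summable_on\<close>).
\<close>

section \<open>Finite and infinite q-shifted factorials\<close>

lemma qpoch_0 [simp]: "qpoch a p 0 = 1"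
  by (simp add: qpoch_def)

lemma qpoch_Suc: "qpoch a p (Suc n) = qpoch a p n * (1 - a * p ^ n)"
  by (simp add: qpoch_def)

lemma norm_mult_power_less_one:
  fixes a p :: "'a::real_normed_field"
  assumes "norm p < 1" "norm a < 1"
  shows "norm (a * p ^ n) < 1"
proof -
  have "norm (a * p ^ n) \<le> norm a * 1"
    unfolding norm_mult norm_power
    by (intro mult_left_mono power_le_one) (use assms in auto)
  with assms show ?thesis by simp
qed

lemma one_minus_mult_power_nonzero:
  fixes a p :: "'a::real_normed_field"
  assumes "norm p < 1" "norm a < 1"
  shows "1 - a * p ^ n \<noteq> 0"
proof
  assume "1 - a * p ^ n = 0"
  then have "norm (a * p ^ n) = norm (1 :: 'a)"
    by (simp only: right_minus_eq)
  with norm_mult_power_less_one[OF assms, of n] show False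
    by simp
qed

lemma qpoch_nonzero:
  fixes a p :: "'a::real_normed_field"
  assumes "norm p < 1" "norm a < 1"
  shows "qpoch a p n \<noteq> 0"
  using one_minus_mult_power_nonzero[OF assms] by (simp add: qpoch_def)

lemma convergent_prod_qpoch:
  fixes a p :: "'a::{real_normed_field,banach}"
  assumes "norm p < 1"
  shows "convergent_prod (\<lambda>j. 1 - a * p ^ j)"
proof (intro abs_convergent_prod_imp_convergent_prod summable_imp_abs_convergent_prod)
  show "summable (\<lambda>j. norm (1 - a * p ^ j - 1))"
    using assms by (simp add: norm_mult norm_power summable_mult summable_geometric)
qed

lemma qpoch_tendsto:
  fixes a p :: "'a::{real_normed_field,banach}"
  assumes "norm p < 1"
  shows "qpoch a p \<longlonglongrightarrow> (\<Prod>j. 1 - a * p ^ j)"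
proof -
  have "(\<lambda>n. \<Prod>j<n. 1 - a * p ^ j) \<longlonglongrightarrow> (\<Prod>j. 1 - a * p ^ j)"
    by (intro has_prod_imp_tendsto' convergent_prod_has_prod convergent_prod_qpoch assms)
  then show ?thesis
    by (simp add: qpoch_def[abs_def])
qed

text \<open>
  The infinite product has no vanishing factor, so the reciprocals of its partial products
  converge. This uniform bound is what makes the series below converge absolutely.
\<close>
lemma inverse_qpoch_bounded:
  fixes a p :: "'a::{real_normed_field,banach}"
  assumes "norm p < 1" "norm a < 1"
  obtains C where "C > 0" "\<And>n. norm (1 / qpoch a p n) \<le> C"
proof -
  have "(\<Prod>j. 1 - a * p ^ j) \<noteq> 0"
    using assms one_minus_mult_power_nonzero[OF assms]
    by (intro prodinf_nonzero convergent_prod_qpoch) auto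
  then have "(\<lambda>n. 1 / qpoch a p n) \<longlonglongrightarrow> 1 / (\<Prod>j. 1 - a * p ^ j)"
    by (intro tendsto_divide tendsto_const qpoch_tendsto assms)
  then have "Bseq (\<lambda>n. 1 / qpoch a p n)"
    by (intro convergent_imp_Bseq convergentI)
  then show ?thesis
    using that unfolding Bseq_def by auto
qed

text \<open>
  In \<open>qpoch (- q) q (2 * n)\<close> the factors with odd and with even exponents separate, and both sides
  are limits of these partial products.
\<close>
lemma prodinf_odd_even:
  fixes q :: "'a::{real_normed_field,banach}"
  assumes q: "norm q < 1"
  shows "(\<Prod>j. 1 + q ^ (2 * j + 1)) * (\<Prod>j. 1 + q\<^sup>2 * (q\<^sup>2) ^ j) = (\<Prod>j. 1 + q ^ (j + 1))"
proof -
  have q2: "norm (q\<^sup>2) < 1"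
    using q by (simp add: norm_power power_less_one_iff)
  have split: "qpoch (- q) q (2 * n) = qpoch (- q) (q\<^sup>2) n * qpoch (- (q\<^sup>2)) (q\<^sup>2) n" for n
  proof (induction n)
    case (Suc n)
    have "q ^ (2 * n) = (q\<^sup>2) ^ n"
      by (rule power_mult)
    then have "qpoch (- q) q (2 * Suc n)
      = qpoch (- q) q (2 * n) * (1 + q * (q\<^sup>2) ^ n) * (1 + q\<^sup>2 * (q\<^sup>2) ^ n)"
      by (simp add: qpoch_Suc power2_eq_square mult.assoc)
    then show ?case
      unfolding Suc.IH by (simp only: qpoch_Suc mult_minus_left diff_minus_eq_add mult_ac)
  qed simp
  have "(\<lambda>n. qpoch (- q) q (2 * n)) \<longlonglongrightarrow> (\<Prod>j. 1 - (- q) * q ^ j)"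
    using LIMSEQ_subseq_LIMSEQ[OF qpoch_tendsto[OF q, of "- q"], of "\<lambda>n. 2 * n"]
    by (simp add: strict_mono_def o_def)
  moreover have "(\<lambda>n. qpoch (- q) q (2 * n)) \<longlonglongrightarrow>
      (\<Prod>j. 1 - (- q) * (q\<^sup>2) ^ j) * (\<Prod>j. 1 - (- (q\<^sup>2)) * (q\<^sup>2) ^ j)"
    unfolding split by (intro tendsto_mult qpoch_tendsto q2)
  ultimately show ?thesis
    using LIMSEQ_unique by (fastforce simp: power_mult)
qed

section \<open>The q-binomial theorem and Euler's series\<close>

lemma choose_two_Suc: "Suc n choose 2 = n + (n choose 2)"
  by (simp add: numeral_2_eq_2)

lemma double_choose_two: "2 * (n choose 2) + n = n\<^sup>2"
  by (induction n) (auto simp: choose_two_Suc power2_eq_square)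

text \<open>
  Dividing by \<open>qpoch p p n\<close> turns the Gaussian binomial coefficients into products of reciprocal
  factorials. Pascal's rule for them comes from the splitting
  \<open>1 - p ^ (n + 1) = (1 - p ^ (n + 1 - i)) + p ^ (n + 1 - i) * (1 - p ^ i)\<close>: the first part cancels the
  last factor of \<open>qpoch p p (n + 1 - i)\<close>, the second that of \<open>qpoch p p i\<close>.
\<close>
lemma qbinomial_theorem:
  fixes p z :: "'a::real_normed_field"
  assumes p: "norm p < 1"
  shows "(\<Sum>i\<le>n. p ^ (i choose 2) * z ^ i / (qpoch p p i * qpoch p p (n - i)))
    = qpoch (- z) p n / qpoch p p n"
proof (induction n)
  case 0
  then show ?case by (simp add: binomial_eq_0)
next
  case (Suc n)
  let ?b = "\<lambda>i. p ^ (i choose 2) * z ^ i"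
  let ?r = "\<lambda>n i. ?b i / (qpoch p p i * qpoch p p (n - i))"
  have nz: "qpoch p p m \<noteq> 0" for m
    by (rule qpoch_nonzero[OF p p])
  have nz1: "1 - p * p ^ m \<noteq> 0" for m
    by (rule one_minus_mult_power_nonzero[OF p p])
  have keep: "(\<Sum>i\<le>Suc n. (1 - p ^ (Suc n - i)) * ?r (Suc n) i) = (\<Sum>i\<le>n. ?r n i)"
  proof -
    have "(1 - p ^ (Suc n - i)) * ?r (Suc n) i = ?r n i" if "i \<le> n" for i
      using nz nz1[of "n - i"] that by (simp add: Suc_diff_le qpoch_Suc)
    then show ?thesis by simp
  qed
  have shift: "(\<Sum>i\<le>Suc n. p ^ (Suc n - i) * (1 - p ^ i) * ?r (Suc n) i)
      = z * p ^ n * (\<Sum>i\<le>n. ?r n i)"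
  proof -
    have "p ^ (n - i) * (1 - p ^ Suc i) * ?r (Suc n) (Suc i) = z * p ^ n * ?r n i"
      if "i \<le> n" for i
    proof -
      have "p ^ (n - i) * ?b (Suc i) = z * p ^ n * ?b i"
        using that by (simp add: choose_two_Suc power_add[symmetric] algebra_simps)
      moreover have "p ^ (n - i) * (1 - p ^ Suc i) * ?r (Suc n) (Suc i)
          = p ^ (n - i) * ?b (Suc i) / (qpoch p p i * qpoch p p (n - i))"
        using nz1[of i] by (simp add: qpoch_Suc)
      ultimately show ?thesis by simp
    qed
    then show ?thesis
      by (subst sum.atMost_Suc_shift) (simp add: sum_distrib_left)
  qed
  have "(1 - p * p ^ n) * (\<Sum>i\<le>Suc n. ?r (Suc n) i)
      = (\<Sum>i\<le>Suc n. ((1 - p ^ (Suc n - i)) + p ^ (Suc n - i) * (1 - p ^ i)) * ?r (Suc n) i)"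
    unfolding sum_distrib_left
  proof (intro sum.cong refl)
    fix i assume "i \<in> {..Suc n}"
    then have "p ^ (Suc n - i) * p ^ i = p * p ^ n"
      by (simp add: power_add[symmetric])
    then show "(1 - p * p ^ n) * ?r (Suc n) i
        = ((1 - p ^ (Suc n - i)) + p ^ (Suc n - i) * (1 - p ^ i)) * ?r (Suc n) i"
      by (simp add: right_diff_distrib)
  qed
  also have "\<dots> = (1 + z * p ^ n) * (\<Sum>i\<le>n. ?r n i)"
    unfolding distrib_right[of _ _ "?r (Suc n) _"] sum.distrib keep shift
    by (simp add: distrib_right)
  also have "\<dots> = (1 + z * p ^ n) * (qpoch (- z) p n / qpoch p p n)"
    by (simp only: Suc.IH)
  finally have "(\<Sum>i\<le>Suc n. ?r (Suc n) i)
      = (1 + z * p ^ n) * (qpoch (- z) p n / qpoch p p n) / (1 - p * p ^ n)"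
    using nz1[of n] by (simp only: nonzero_eq_divide_eq mult.commute not_False_eq_True)
  also have "\<dots> = qpoch (- z) p (Suc n) / qpoch p p (Suc n)"
    by (simp add: qpoch_Suc mult_ac)
  finally show ?case .
qed

text \<open>
  The series, as a function \<open>F\<close> of \<open>z\<close>, satisfies \<open>F z = (1 + z) * F (p * z)\<close>. Iterating this produces
  the partial products, while the argument of \<open>F\<close> tends to \<open>0\<close>, where \<open>F\<close> is continuous with
  value \<open>1\<close>.
\<close>
lemma euler_sums:
  fixes p z :: "'a::{real_normed_field,banach}"
  assumes p: "norm p < 1" and z: "norm z < 1"
  shows "(\<lambda>n. p ^ (n choose 2) * z ^ n / qpoch p p n) sums (\<Prod>j. 1 + z * p ^ j)"
proof -
  define c where "c n = p ^ (n choose 2) / qpoch p p n" for n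
  define F where "F x = (\<Sum>n. c n * x ^ n)" for x
  obtain C where C: "C > 0" "\<And>n. norm (1 / qpoch p p n) \<le> C"
    using inverse_qpoch_bounded[OF p p] by metis
  have c_le: "norm (c n) \<le> C" for n
  proof -
    have "norm (c n) = norm (p ^ (n choose 2)) * norm (1 / qpoch p p n)"
      by (simp add: c_def norm_divide)
    also have "\<dots> \<le> 1 * C"
      using C p by (intro mult_mono) (auto simp: norm_power power_le_one)
    finally show ?thesis by simp
  qed
  have summ: "summable (\<lambda>n. c n * x ^ n)" if "norm x < 1" for x
  proof (rule summable_comparison_test')
    show "summable (\<lambda>n. C * norm x ^ n)"
      using that by (intro summable_mult summable_geometric) simp
    show "norm (c n * x ^ n) \<le> C * norm x ^ n" for n
      by (simp add: norm_mult norm_power mult_right_mono c_le)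
  qed
  have step: "F x = (1 + x) * F (p * x)" if x: "norm x < 1" for x
  proof -
    have px: "norm (p * x) < 1"
      using norm_mult_power_less_one[OF p x, of 1] by (simp add: mult.commute)
    have "F x - F (p * x) = (\<Sum>n. c n * x ^ n - c n * (p * x) ^ n)"
      unfolding F_def by (rule suminf_diff[OF summ[OF x] summ[OF px]])
    also have "\<dots> = (\<Sum>n. c (Suc n) * x ^ Suc n - c (Suc n) * (p * x) ^ Suc n)"
      using suminf_split_head[OF summable_diff[OF summ[OF x] summ[OF px]]] by simp
    also have "\<dots> = (\<Sum>n. x * (c n * (p * x) ^ n))"
    proof (rule suminf_cong)
      fix n
      have "1 - p * p ^ n \<noteq> 0"
        by (rule one_minus_mult_power_nonzero[OF p p])
      then have "c (Suc n) * (1 - p * p ^ n) = c n * p ^ n"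
        using qpoch_nonzero[OF p p, of n]
        by (simp add: c_def qpoch_Suc choose_two_Suc power_add)
      then have "c (Suc n) * (1 - p * p ^ n) * x ^ Suc n = c n * p ^ n * x ^ Suc n"
        by simp
      then show "c (Suc n) * x ^ Suc n - c (Suc n) * (p * x) ^ Suc n = x * (c n * (p * x) ^ n)"
        by (simp add: power_mult_distrib algebra_simps)
    qed
    also have "\<dots> = x * F (p * x)"
      unfolding F_def by (rule suminf_mult[OF summ[OF px]])
    finally show ?thesis by (simp add: algebra_simps)
  qed
  have iter: "F z = qpoch (- z) p n * F (z * p ^ n)" for n
  proof (induction n)
    case (Suc n)
    then show ?case
      using step[OF norm_mult_power_less_one[OF p z, of n]]
      by (simp add: qpoch_Suc mult_ac)
  qed simp
  have "isCont F 0"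
    unfolding F_def
    by (rule isCont_powser[OF summ[of "1/2"]]) (simp_all add: norm_divide)
  moreover have "(\<lambda>n. z * p ^ n) \<longlonglongrightarrow> 0"
    using p by (intro tendsto_mult_right_zero LIMSEQ_power_zero)
  ultimately have "(\<lambda>n. F (z * p ^ n)) \<longlonglongrightarrow> F 0"
    by (rule isCont_tendsto_compose)
  then have "(\<lambda>n. qpoch (- z) p n * F (z * p ^ n)) \<longlonglongrightarrow> (\<Prod>j. 1 - (- z) * p ^ j) * F 0"
    by (intro tendsto_mult qpoch_tendsto p)
  moreover have "F 0 = 1"
    using powser_sums_zero[of c] by (simp add: F_def c_def sums_iff binomial_eq_0)
  ultimately have "(\<lambda>n. F z) \<longlonglongrightarrow> (\<Prod>j. 1 + z * p ^ j)"
    using iter by simp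
  then have "F z = (\<Prod>j. 1 + z * p ^ j)"
    by (simp add: LIMSEQ_const_iff)
  with summ[OF z] show ?thesis
    by (simp add: F_def c_def sums_iff)
qed

section \<open>Rearranging multiple series\<close>

lemma suminf_eq_infsum:
  fixes f :: "nat \<Rightarrow> 'a::{topological_comm_monoid_add,t2_space}"
  assumes "f summable_on UNIV"
  shows "suminf f = infsum f UNIV"
  using has_sum_imp_sums[OF has_sum_infsum[OF assms]] by (simp add: sums_iff)

lemma suminf_infsum_Pair:
  fixes f :: "nat \<times> 'b \<Rightarrow> 'a::banach"
  assumes "f summable_on UNIV"
  shows "(\<Sum>x. \<Sum>\<^sub>\<infinity>y. f (x, y)) = infsum f UNIV"
proof -
  have *: "(\<lambda>(x, y). f (x, y)) summable_on UNIV \<times> UNIV"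
    using assms by simp
  show ?thesis
    using suminf_eq_infsum[OF summable_on_Sigma_banach[OF *]] infsum_Sigma'_banach[OF *] by simp
qed

lemma summable_on_Pair:
  fixes f :: "'b \<times> 'c \<Rightarrow> 'a::banach"
  assumes "f summable_on UNIV"
  shows "(\<lambda>y. f (x, y)) summable_on UNIV"
proof -
  have "f summable_on range (Pair x)"
    using assms summable_on_subset_banach by blast
  then show ?thesis
    by (subst (asm) summable_on_reindex) (auto simp: inj_on_def o_def)
qed

lemma summable_on_times_nonneg:
  fixes f :: "'b \<Rightarrow> real" and g :: "'c \<Rightarrow> real"
  assumes "f summable_on UNIV" "g summable_on UNIV" "\<And>x. f x \<ge> 0" "\<And>y. g y \<ge> 0"
  shows "(\<lambda>(x, y). f x * g y) summable_on UNIV"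
proof -
  have "(\<lambda>(x, y). f x * g y) summable_on UNIV \<times> UNIV"
  proof (rule summable_on_SigmaI)
    show "((\<lambda>y. case (x, y) of (x, y) \<Rightarrow> f x * g y) has_sum f x * infsum g UNIV) UNIV" for x
      by (auto intro!: has_sum_cmult_right has_sum_infsum assms)
    show "(\<lambda>x. f x * infsum g UNIV) summable_on UNIV"
      by (intro summable_on_cmult_left assms)
  qed (use assms in auto)
  then show ?thesis by simp
qed

lemma infsum_antidiagonal:
  fixes g :: "nat \<times> nat \<Rightarrow> 'a::banach"
  assumes "g summable_on UNIV"
  shows "infsum g UNIV = (\<Sum>n. \<Sum>i\<le>n. g (i, n - i))"
proof -
  let ?T = "Sigma UNIV (\<lambda>n::nat. {..n})"
  let ?g = "\<lambda>(n, i). g (i, n - i)"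
  have summ: "?g summable_on ?T"
    using assms
    by (subst summable_on_reindex_bij_witness
        [of _ "\<lambda>(i, k). (i + k, i)" "\<lambda>(n, i). (i, n - i)" UNIV g]) auto
  have "infsum g UNIV = infsum ?g ?T"
    by (rule infsum_reindex_bij_witness[of _ "\<lambda>(n, i). (i, n - i)" "\<lambda>(i, k). (i + k, i)"]) auto
  also have "\<dots> = (\<Sum>\<^sub>\<infinity>n. \<Sum>\<^sub>\<infinity>i\<in>{..n}. g (i, n - i))"
    using infsum_Sigma'_banach[OF summ] by simp
  also have "\<dots> = (\<Sum>n. \<Sum>i\<le>n. g (i, n - i))"
    using suminf_eq_infsum[OF summable_on_Sigma_banach[OF summ]] by simp
  finally show ?thesis .
qed

section \<open>The triple series\<close>

text \<open>
  The coefficients are bounded and the exponent is at least \<open>h + i + k\<close>, so a product of three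
  geometric series dominates.
\<close>
lemma triple_summable_on:
  fixes q :: complex
  assumes q: "norm q < 1"
  shows "(\<lambda>(h, i, k). q ^ (k + i + 2 * i * (h + i + k) + (h + k)\<^sup>2)
            / (qpoch (q\<^sup>2) (q\<^sup>2) h * qpoch (q\<^sup>2) (q\<^sup>2) i * qpoch (q\<^sup>2) (q\<^sup>2) k))
          summable_on UNIV"
    (is "?f summable_on UNIV")
proof -
  have q2: "norm (q\<^sup>2) < 1"
    using q by (simp add: norm_power power_less_one_iff)
  obtain C where C: "C > 0" "\<And>n. norm (1 / qpoch (q\<^sup>2) (q\<^sup>2) n) \<le> C"
    using inverse_qpoch_bounded[OF q2 q2] by metis
  let ?r = "norm q"
  have geo: "(\<lambda>n. ?r ^ n) summable_on UNIV"
    using q by (intro norm_summable_imp_summable_on) (simp add: summable_geometric)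
  have "(\<lambda>(i, k). ?r ^ i * ?r ^ k) summable_on UNIV"
    by (intro summable_on_times_nonneg geo) auto
  then have "(\<lambda>(h, x). ?r ^ h * (case x of (i, k) \<Rightarrow> ?r ^ i * ?r ^ k)) summable_on UNIV"
    by (intro summable_on_times_nonneg geo) auto
  then have majorant: "(\<lambda>x. C ^ 3 * (case x of (h, i, k) \<Rightarrow> ?r ^ (h + i + k))) summable_on UNIV"
    by (intro summable_on_cmult_right) (simp add: case_prod_unfold power_add mult.assoc)
  have bound: "norm (?f x) \<le> C ^ 3 * (case x of (h, i, k) \<Rightarrow> ?r ^ (h + i + k))" for x
  proof -
    obtain h i k where x: "x = (h, i, k)" by (cases x)
    let ?e = "k + i + 2 * i * (h + i + k) + (h + k)\<^sup>2"
    let ?u = "\<lambda>n. 1 / qpoch (q\<^sup>2) (q\<^sup>2) n"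
    have "h \<le> (h + k)\<^sup>2"
      using self_le_power[of "h + k" 2] by (cases "h + k = 0") auto
    then have power_le: "?r ^ ?e \<le> ?r ^ (h + i + k)"
      using q by (intro power_decreasing) auto
    have coeff_le: "norm (?u h) * (norm (?u i) * norm (?u k)) \<le> C * (C * C)"
      using C(1) by (intro mult_mono C(2) mult_nonneg_nonneg) auto
    have "(norm (?u h) * (norm (?u i) * norm (?u k))) * ?r ^ ?e
        \<le> (C * (C * C)) * ?r ^ (h + i + k)"
      by (rule mult_mono[OF coeff_le power_le]) (use C(1) in auto)
    then show ?thesis
      by (simp add: x norm_mult norm_divide norm_power power3_eq_cube mult_ac)
  qed
  show ?thesis
    by (rule abs_summable_summable, rule summable_on_comparison_test[OF majorant])
      (use bound in auto)
qed

text \<open>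
  As a function of \<open>h\<close> the exponent is \<open>2 * (h choose 2) + (1 + 2 * (i + k)) * h\<close> up to a constant,
  so this is Euler's series in base \<open>q\<^sup>2\<close> at \<open>z = q * (q\<^sup>2) ^ (i + k)\<close>. The constant part is split as
  \<open>(i + k) * (i + k + 1) + i\<^sup>2\<close>, so that only the last factor varies on a diagonal \<open>i + k = n\<close>.
\<close>
lemma triple_sums_over_first_index:
  fixes q :: complex
  assumes q: "norm q < 1"
  shows "(\<lambda>h. q ^ (k + i + 2 * i * (h + i + k) + (h + k)\<^sup>2)
            / (qpoch (q\<^sup>2) (q\<^sup>2) h * qpoch (q\<^sup>2) (q\<^sup>2) i * qpoch (q\<^sup>2) (q\<^sup>2) k))
    sums ((\<Prod>j. 1 + q ^ (2 * j + 1)) / qpoch (- q) (q\<^sup>2) (i + k) * q ^ ((i + k) * (i + k + 1))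
      * (q ^ i\<^sup>2 / (qpoch (q\<^sup>2) (q\<^sup>2) i * qpoch (q\<^sup>2) (q\<^sup>2) k)))"
    (is "?f sums (?P / ?Q * ?a * ?b)")
proof -
  have q2: "norm (q\<^sup>2) < 1"
    using q by (simp add: norm_power power_less_one_iff)
  define z where "z = q * (q\<^sup>2) ^ (i + k)"
  have z: "norm z < 1"
    unfolding z_def by (rule norm_mult_power_less_one[OF q2 q])
  have f_eq: "?a * ?b * ((q\<^sup>2) ^ (h choose 2) * z ^ h / qpoch (q\<^sup>2) (q\<^sup>2) h) = ?f h" for h
  proof -
    have "(i + k) * (i + k + 1) + i\<^sup>2 + (2 * (h choose 2) + (1 + 2 * (i + k)) * h)
        = k + i + 2 * i * (h + i + k) + (h + k)\<^sup>2"
      using double_choose_two[of h] by (simp add: power2_eq_square algebra_simps)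
    then have "q ^ (k + i + 2 * i * (h + i + k) + (h + k)\<^sup>2)
        = ?a * q ^ i\<^sup>2 * (q ^ (2 * (h choose 2)) * q ^ ((1 + 2 * (i + k)) * h))"
      by (simp only: power_add[symmetric])
    also have "q ^ ((1 + 2 * (i + k)) * h) = z ^ h"
      unfolding z_def by (simp only: power_mult power_add power_one_right)
    also have "q ^ (2 * (h choose 2)) = (q\<^sup>2) ^ (h choose 2)"
      by (rule power_mult)
    finally show ?thesis by simp
  qed
  have nz: "1 - (- q) * (q\<^sup>2) ^ j \<noteq> 0" for j
    by (rule one_minus_mult_power_nonzero[OF q2]) (use q in simp)
  have "?P = (\<Prod>j. 1 - (- q) * (q\<^sup>2) ^ j)"
    by (simp add: power_mult)
  also have "\<dots> = (\<Prod>j. 1 - (- q) * (q\<^sup>2) ^ (j + (i + k))) * ?Q"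
    unfolding qpoch_def by (rule prodinf_split_initial_segment[OF convergent_prod_qpoch[OF q2] nz])
  also have "(\<Prod>j. 1 - (- q) * (q\<^sup>2) ^ (j + (i + k))) = (\<Prod>j. 1 + z * (q\<^sup>2) ^ j)"
    by (simp add: z_def power_add mult_ac)
  finally have "(\<Prod>j. 1 + z * (q\<^sup>2) ^ j) = ?P / ?Q"
    using qpoch_nonzero[OF q2, of "- q" "i + k"] q by simp
  then show ?thesis
    using sums_mult[OF euler_sums[OF q2 z], of "?a * ?b"] unfolding f_eq by (simp only: mult_ac)
qed

theorem mainTheorem17:
  fixes q :: complex
  assumes "norm q < 1"
  shows "convergent_prod (\<lambda>j. 1 + q ^ (j + 1))
    \<and> ((\<lambda>(h, i, k). q ^ (k + i + 2 * i * (h + i + k) + (h + k)\<^sup>2)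
            / (qpoch (q\<^sup>2) (q\<^sup>2) h * qpoch (q\<^sup>2) (q\<^sup>2) i * qpoch (q\<^sup>2) (q\<^sup>2) k))
          summable_on UNIV)
    \<and> (\<Sum>h. \<Sum>i. \<Sum>k. q ^ (k + i + 2 * i * (h + i + k) + (h + k)\<^sup>2)
            / (qpoch (q\<^sup>2) (q\<^sup>2) h * qpoch (q\<^sup>2) (q\<^sup>2) i * qpoch (q\<^sup>2) (q\<^sup>2) k))
          = (\<Prod>j. 1 + q ^ (j + 1))
    \<and> convergent_prod (\<lambda>j. 1 + q ^ (2 * j + 1))
    \<and> summable (\<lambda>j. q ^ (j * (j + 1)) / qpoch (q\<^sup>2) (q\<^sup>2) j)
    \<and> (\<Prod>j. 1 + q ^ (2 * j + 1)) * (\<Sum>j. q ^ (j * (j + 1)) / qpoch (q\<^sup>2) (q\<^sup>2) j)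
          = (\<Prod>j. 1 + q ^ (j + 1))"
proof -
  let ?p = "q\<^sup>2"
  let ?P = "\<Prod>j. 1 + q ^ (2 * j + 1)"
  let ?R = "\<Prod>j. 1 + q ^ (j + 1)"
  let ?s = "\<lambda>n. q ^ (n * (n + 1)) / qpoch ?p ?p n"
  define f where "f = (\<lambda>(h, i, k). q ^ (k + i + 2 * i * (h + i + k) + (h + k)\<^sup>2)
            / (qpoch ?p ?p h * qpoch ?p ?p i * qpoch ?p ?p k))"
  have p: "norm ?p < 1"
    using assms by (simp add: norm_power power_less_one_iff)
  have conv: "convergent_prod (\<lambda>j. 1 + q ^ (j + 1))"
    using convergent_prod_qpoch[OF assms, of "- q"] by simp
  have conv_odd: "convergent_prod (\<lambda>j. 1 + q ^ (2 * j + 1))"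
    using convergent_prod_qpoch[OF p, of "- q"] by (simp add: power_mult)
  have "?p ^ (n choose 2) * ?p ^ n = q ^ (n * (n + 1))" for n
  proof -
    have "2 * (n choose 2) + 2 * n = n * (n + 1)"
      using double_choose_two[of n] by (simp add: power2_eq_square)
    then show ?thesis
      by (simp only: power_mult[symmetric] power_add[symmetric])
  qed
  then have s_sums: "?s sums (\<Prod>j. 1 + ?p * ?p ^ j)"
    using euler_sums[OF p p] by simp
  have second: "?P * suminf ?s = ?R"
    using s_sums prodinf_odd_even[OF assms] by (simp add: sums_iff)

  have summ: "f summable_on UNIV"
    unfolding f_def by (rule triple_summable_on[OF assms])
  define g where "g = (\<lambda>(i, k). \<Sum>\<^sub>\<infinity>h. f (h, i, k))"
  have "(\<lambda>(h, x). f (h, x)) summable_on UNIV \<times> UNIV"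
    using summ by simp
  then have swapped: "(\<lambda>(x, h). f (h, x)) summable_on UNIV \<times> UNIV"
    by (subst (asm) summable_on_swap) simp
  have "(\<lambda>x. \<Sum>\<^sub>\<infinity>h. f (h, x)) = g"
    by (auto simp: g_def)
  then have g_summ: "g summable_on UNIV" and g_sum: "infsum g UNIV = infsum f UNIV"
    using summable_on_Sigma_banach[OF swapped] infsum_swap_banach[of "\<lambda>h x. f (h, x)" UNIV UNIV]
      infsum_Sigma'_banach[of "\<lambda>h x. f (h, x)" UNIV "\<lambda>_. UNIV"] summ by auto
  have g_eq: "g (i, k) = ?P / qpoch (- q) ?p (i + k) * q ^ ((i + k) * (i + k + 1))
      * (q ^ i\<^sup>2 / (qpoch ?p ?p i * qpoch ?p ?p k))" for i k
  proof -
    have "(\<lambda>h. f (h, i, k)) summable_on UNIV"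
      using summable_on_SigmaD1[OF swapped, of "(i, k)"] by simp
    then have "g (i, k) = (\<Sum>h. f (h, i, k))"
      by (simp add: g_def suminf_eq_infsum)
    then show ?thesis
      using triple_sums_over_first_index[OF assms, of k i] by (simp add: f_def sums_iff)
  qed
  \<comment> \<open>The factor \<open>qpoch (- q) ?p n\<close> left in the denominator by the tail product cancels against the
    finite product in the q-binomial theorem.\<close>
  have diagonal: "(\<Sum>i\<le>n. g (i, n - i)) = ?P * ?s n" for n
  proof -
    have "?p ^ (i choose 2) * q ^ i = q ^ i\<^sup>2" for i
      using double_choose_two[of i] by (simp only: power_mult[symmetric] power_add[symmetric])
    then have fin: "(\<Sum>i\<le>n. q ^ i\<^sup>2 / (qpoch ?p ?p i * qpoch ?p ?p (n - i)))
        = qpoch (- q) ?p n / qpoch ?p ?p n"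
      using qbinomial_theorem[OF p, of q n] by simp
    have "(\<Sum>i\<le>n. g (i, n - i)) = (\<Sum>i\<le>n. ?P / qpoch (- q) ?p n * q ^ (n * (n + 1))
        * (q ^ i\<^sup>2 / (qpoch ?p ?p i * qpoch ?p ?p (n - i))))"
      by (rule sum.cong) (simp_all add: g_eq)
    also have "\<dots> = ?P / qpoch (- q) ?p n * q ^ (n * (n + 1)) * (qpoch (- q) ?p n / qpoch ?p ?p n)"
      by (simp only: sum_distrib_left[symmetric] fin)
    also have "\<dots> = ?P * ?s n"
      using qpoch_nonzero[OF p, of "- q" n] assms by simp
    finally show ?thesis .
  qed
  have inner: "(\<Sum>i. \<Sum>k. f (h, i, k)) = (\<Sum>\<^sub>\<infinity>x. f (h, x))" for h
  proof -
    have h: "(\<lambda>x. f (h, x)) summable_on UNIV"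
      by (rule summable_on_Pair[OF summ])
    have "(\<Sum>k. f (h, i, k)) = (\<Sum>\<^sub>\<infinity>k. f (h, i, k))" for i
      by (rule suminf_eq_infsum[OF summable_on_Pair[OF h]])
    then show ?thesis
      using suminf_infsum_Pair[OF h] by simp
  qed
  have "(\<Sum>h. \<Sum>i. \<Sum>k. f (h, i, k)) = infsum f UNIV"
    unfolding inner by (rule suminf_infsum_Pair[OF summ])
  also have "\<dots> = (\<Sum>n. ?P * ?s n)"
    unfolding g_sum[symmetric] infsum_antidiagonal[OF g_summ] diagonal ..
  also have "\<dots> = ?R"
    using suminf_mult[OF sums_summable[OF s_sums], of ?P] second by simp
  finally have first: "(\<Sum>h. \<Sum>i. \<Sum>k. f (h, i, k)) = ?R" .
  show ?thesis
    using conv summ first conv_odd sums_summable[OF s_sums] second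
    unfolding f_def prod.case by blast
qed

end
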